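(* Let $n\geq 2$ be an integer, let $b:=-n+i$, let $D\subset\{0,1,\ldots,n^{2}\}$ and put $\Delta:=D-D=\{d-d': d,d'\in D\}$. Suppose one of the following holds: (i) $n\geq 2$, $D\subset\{0,1,\ldots,\lfloor n^{2}/2\rfloor\}$, and $|\delta-\delta'|\neq 1$ for all $\delta,\delta'\in\Delta$; (ii) $n\geq 5$ and $|\delta-\delta'|>2$ for all $\delta\neq\delta'$ in $\Delta$; (iii) $n\in\{2,3,4\}$ and $|\delta-\delta'|>3$ for all $\delta\neq\delta'$ in $\Delta$. Then the level sets of $\Phi_{n,D}$ are dense in $F_{n,D}$; that is, for every $\lambda\in[0,\dim_{B}C_{n,D}]$ the set $\Phi_{n,D}^{-1}(\{\lambda\})$ is dense in $F_{n,D}$.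
   Context: $C_{n,D}$ denotes the attractor of the iterated function system $\{f_{d}(z)=b^{-1}(z+d): d\in D\}$ on $\mathbb{C}$, i.e. the unique nonempty compact set with $C_{n,D}=\bigcup_{d\in D}f_d(C_{n,D})$; equivalently $C_{n,D}=\{\sum_{j\ge1}d_jb^{-j}: d_j\in D\}$. For $\alpha\in\mathbb{C}$ let $C(\alpha):=C_{n,D}\cap(C_{n,D}+\alpha)$. $F_{n,D}:=\{\alpha\in\mathbb{C}: C(\alpha)\neq\emptyset\}$. $\dim_B$ denotes box-counting dimension (the common value of the upper and lower box-counting dimensions, when they agree). $\Phi_{n,D}$ is the function defined on $\{\alpha\in F_{n,D}: \dim_B C(\alpha)\text{ exists}\}$ with values in $[0,\dim_B C_{n,D}]$ given by $\Phi_{n,D}(\alpha)=\dim_B C(\alpha)$. *)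

theory Defs
  imports "HOL-Analysis.Analysis"
begin

definition base :: "nat \<Rightarrow> complex" where
  "base n = - of_nat n + \<i>"

definition Cset :: "nat \<Rightarrow> int set \<Rightarrow> complex set" where
  "Cset n D = {x. \<exists>d::nat \<Rightarrow> int. (\<forall>j. d j \<in> D) \<and>
        (\<lambda>j. of_int (d j) * inverse (base n) ^ (Suc j)) sums x}"

definition Calpha :: "nat \<Rightarrow> int set \<Rightarrow> complex \<Rightarrow> complex set" where
  "Calpha n D \<alpha> = Cset n D \<inter> ((\<lambda>x. x + \<alpha>) ` Cset n D)"

definition Fset :: "nat \<Rightarrow> int set \<Rightarrow> complex set" where
  "Fset n D = {\<alpha>. Calpha n D \<alpha> \<noteq> {}}"

definition cover_num :: "'a::metric_space set \<Rightarrow> real \<Rightarrow> nat" where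
  "cover_num A r = Inf {card T | T. finite T \<and> A \<subseteq> (\<Union>t\<in>T. cball t r)}"

definition upper_box_dim :: "'a::metric_space set \<Rightarrow> ereal" where
  "upper_box_dim A = Limsup (at_right 0) (\<lambda>r. ereal (ln (real (cover_num A r)) / - ln r))"

definition lower_box_dim :: "'a::metric_space set \<Rightarrow> ereal" where
  "lower_box_dim A = Liminf (at_right 0) (\<lambda>r. ereal (ln (real (cover_num A r)) / - ln r))"

definition has_box_dim :: "'a::metric_space set \<Rightarrow> real \<Rightarrow> bool" where
  "has_box_dim A d \<longleftrightarrow> bounded A \<and> A \<noteq> {} \<and>
     upper_box_dim A = ereal d \<and> lower_box_dim A = ereal d"

definition box_dim :: "'a::metric_space set \<Rightarrow> real" where
  "box_dim A = (THE d. has_box_dim A d)"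

definition level_set :: "nat \<Rightarrow> int set \<Rightarrow> real \<Rightarrow> complex set" where
  "level_set n D l = {\<alpha> \<in> Fset n D. has_box_dim (Calpha n D \<alpha>) l}"

definition diffset :: "int set \<Rightarrow> int set" where
  "diffset D = {d - d' | d d'. d \<in> D \<and> d' \<in> D}"

end

theory Submission
  imports Defs "HOL-Real_Asymp.Real_Asymp"
begin

text \<open>
  Write \<open>w = 1/b\<close>. The separation hypotheses force expansions \<open>\<Sum> \<delta>\<^sub>j w\<^sup>j\<close> with \<open>\<delta>\<^sub>j \<in> \<Delta>\<close> to be unique,
  so for \<open>\<alpha>\<close> with digits \<open>\<delta>\<^sub>j\<close> the set \<open>C(\<alpha>)\<close> consists of all expansions whose \<open>j\<close>-th digit lies in
  \<open>D \<inter> (D + \<delta>\<^sub>j)\<close>. Distinct digit prefixes of length \<open>k\<close> differ by \<open>w\<^sup>k\<close> times a nonzero Gaussian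
  integer, hence the box dimension of such a set is the Cesaro limit of \<open>ln \<bar>D \<inter> (D + \<delta>\<^sub>j)\<bar>\<close> divided
  by \<open>ln \<bar>b\<bar>\<close>. The digits \<open>0\<close> and \<open>Max D - Min D\<close> contribute \<open>ln \<bar>D\<bar>\<close> and \<open>0\<close>; mixing them with
  a prescribed frequency after an arbitrarily long prefix of the digits of any point of \<open>F\<close> realises
  every dimension in the range arbitrarily close to that point.
\<close>

section \<open>Power series with bounded integer digits\<close>

text \<open>A total function built on \<open>suminf\<close>; bounded digits and |w| < 1 give
  convergence, and \<open>radix_sums\<close> links it to the \<open>sums\<close> form used in
  \<open>Cset\<close>.\<close>

definition radix_sum :: "complex \<Rightarrow> (nat \<Rightarrow> int) \<Rightarrow> complex" where
  "radix_sum w e = (\<Sum>j. of_int (e j) * w ^ Suc j)"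

lemma norm_radix_term_le:
  fixes w :: complex
  assumes "\<bar>e j\<bar> \<le> B"
  shows "norm (of_int (e j) * w ^ Suc j) \<le> of_int B * norm w ^ Suc j"
proof -
  have "norm (of_int (e j) :: complex) \<le> of_int B"
    using assms by (metis norm_of_int of_int_abs of_int_le_iff)
  thus ?thesis by (simp only: norm_mult norm_power mult_right_mono zero_le_power norm_ge_zero)
qed

lemma summable_radix:
  fixes w :: complex
  assumes "norm w < 1" "\<And>j. \<bar>e j\<bar> \<le> B"
  shows "summable (\<lambda>j. of_int (e j) * w ^ Suc j)"
proof (rule summable_comparison_test')
  show "summable (\<lambda>j. of_int B * norm w ^ Suc j)"
    using assms(1) by (simp add: summable_mult summable_geometric)
qed (rule norm_radix_term_le[OF assms(2)])

lemma radix_sums: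
  assumes "norm w < 1" "\<And>j. \<bar>e j\<bar> \<le> B"
  shows "(\<lambda>j. of_int (e j) * w ^ Suc j) sums radix_sum w e"
  using summable_radix[OF assms] by (simp add: radix_sum_def summable_sums)

text \<open>The tail is again an expansion with digits of the same size, so the bounds below apply
  to it uniformly in k: points sharing k digits are O(|w|^k) apart.\<close>

lemma radix_sum_split:
  assumes "norm w < 1" "\<And>j. \<bar>e j\<bar> \<le> B"
  shows "radix_sum w e = (\<Sum>j<k. of_int (e j) * w ^ Suc j) + w ^ k * radix_sum w (\<lambda>j. e (j + k))"
proof -
  have "radix_sum w e = (\<Sum>j. of_int (e (j + k)) * w ^ Suc (j + k)) + (\<Sum>j<k. of_int (e j) * w ^ Suc j)"
    unfolding radix_sum_def by (rule suminf_split_initial_segment[OF summable_radix[OF assms]])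
  also have "(\<Sum>j. of_int (e (j + k)) * w ^ Suc (j + k)) = (\<Sum>j. w ^ k * (of_int (e (j + k)) * w ^ Suc j))"
    by (simp add: power_add mult_ac)
  also have "\<dots> = w ^ k * radix_sum w (\<lambda>j. e (j + k))"
    unfolding radix_sum_def
    by (rule suminf_mult) (rule summable_radix[where B = B], use assms in auto)
  finally show ?thesis by simp
qed

lemma norm_radix_sum_le:
  assumes "norm w < 1" "\<And>j. \<bar>e j\<bar> \<le> B"
  shows "norm (radix_sum w e) \<le> of_int B * (norm w / (1 - norm w))"
proof -
  have *: "(\<lambda>j. of_int B * norm w ^ Suc j) sums (of_int B * (norm w * (1 / (1 - norm w))))"
    unfolding power_Suc by (intro sums_mult geometric_sums) (use assms in simp)
  have "norm (radix_sum w e) \<le> (\<Sum>j. of_int B * norm w ^ Suc j)"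
    unfolding radix_sum_def
    by (rule norm_suminf_le[OF norm_radix_term_le[OF assms(2)] sums_summable[OF *]])
  also have "\<dots> = of_int B * (norm w * (1 / (1 - norm w)))"
    using * by (simp add: sums_iff)
  finally show ?thesis by simp
qed

lemma radix_sum_diff:
  assumes "norm w < 1" "\<And>j. \<bar>e j\<bar> \<le> B" "\<And>j. \<bar>f j\<bar> \<le> B"
  shows "radix_sum w (\<lambda>j. e j - f j) = radix_sum w e - radix_sum w f"
proof -
  have "(\<lambda>j. of_int (e j) * w ^ Suc j - of_int (f j) * w ^ Suc j) sums (radix_sum w e - radix_sum w f)"
    by (intro sums_diff radix_sums[where B = B]) (use assms in auto)
  thus ?thesis
    unfolding radix_sum_def by (simp add: sums_iff left_diff_distrib)
qed

text \<open>Induction on Im(w w^j) = Re w Im(w^j) + Im w Re(w^j). The gain over the trivial bound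
  |w|^j is the factor |Im w|, which for w = 1/b is only |w|^2. At j = 0 the truncated exponent is
  harmless because the factor j vanishes.\<close>

lemma abs_Im_power_le: "\<bar>Im (w ^ j)\<bar> \<le> real j * \<bar>Im w\<bar> * norm w ^ (j - 1)"
proof (induction j)
  case (Suc j)
  have "\<bar>Im (w ^ Suc j)\<bar> \<le> \<bar>Re w * Im (w ^ j)\<bar> + \<bar>Im w * Re (w ^ j)\<bar>"
    by simp
  also have "\<dots> \<le> norm w * \<bar>Im (w ^ j)\<bar> + \<bar>Im w\<bar> * norm w ^ j"
    unfolding abs_mult norm_power[symmetric]
    by (intro add_mono mult_mono abs_Re_le_cmod) auto
  also have "\<dots> \<le> norm w * (real j * \<bar>Im w\<bar> * norm w ^ (j - 1)) + \<bar>Im w\<bar> * norm w ^ j"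
    using Suc by (intro add_mono mult_left_mono) auto
  also have "\<dots> = real (Suc j) * \<bar>Im w\<bar> * norm w ^ j"
    by (cases j) (auto simp: algebra_simps)
  finally show ?case by simp
qed simp

text \<open>Termwise use of the previous bound, summed by the differentiated geometric
  series.\<close>

lemma abs_Im_radix_sum_le:
  assumes "norm w < 1" "\<And>j. \<bar>e j\<bar> \<le> B"
  shows "\<bar>Im (radix_sum w e)\<bar> \<le> of_int B * \<bar>Im w\<bar> / (1 - norm w)\<^sup>2"
proof -
  have s: "(\<lambda>j. Im (of_int (e j) * w ^ Suc j)) sums Im (radix_sum w e)"
    using radix_sums[OF assms] by (rule sums_Im)
  have g: "(\<lambda>j. of_int B * \<bar>Im w\<bar> * (real (Suc j) * norm w ^ j)) sums
      (of_int B * \<bar>Im w\<bar> * (1 / (1 - norm w)\<^sup>2))"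
    using geometric_deriv_sums[of "norm w"] assms(1) by (intro sums_mult) simp
  have le: "norm (Im (of_int (e j) * w ^ Suc j)) \<le> of_int B * \<bar>Im w\<bar> * (real (Suc j) * norm w ^ j)" for j
  proof -
    have "norm (Im (of_int (e j) * w ^ Suc j)) = of_int \<bar>e j\<bar> * \<bar>Im (w ^ Suc j)\<bar>"
      by (simp add: abs_mult del: power_Suc)
    also have "\<dots> \<le> of_int B * (real (Suc j) * \<bar>Im w\<bar> * norm w ^ (Suc j - 1))"
      using assms(2)[of j] abs_Im_power_le[of w "Suc j"]
      by (intro mult_mono) (simp_all del: power_Suc of_int_abs)
    finally show ?thesis by (simp add: mult_ac)
  qed
  have "norm (\<Sum>j. Im (of_int (e j) * w ^ Suc j)) \<le> (\<Sum>j. of_int B * \<bar>Im w\<bar> * (real (Suc j) * norm w ^ j))"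
    by (rule norm_suminf_le[OF le]) (rule sums_summable[OF g])
  thus ?thesis using s g by (simp add: sums_iff)
qed

section \<open>The base -n+i and uniqueness of expansions\<close>

lemma norm_base: "norm (base n) = sqrt (real n ^ 2 + 1)"
  by (simp add: base_def cmod_def)

lemma base_nz: "base n \<noteq> 0"
  by (simp add: base_def complex_eq_iff)

lemma norm_base_gt_1: "n \<ge> 1 \<Longrightarrow> 1 < norm (base n)"
  by (simp add: norm_base)

lemma norm_inverse_base_less_1: "n \<ge> 1 \<Longrightarrow> norm (inverse (base n)) < 1"
  using norm_base_gt_1[of n] by (simp add: norm_inverse inverse_less_1_iff)

text \<open>Multiplying the vanishing expansion by \<open>b\<^sup>2\<close> leaves \<open>b e\<^sub>0 + e\<^sub>1\<close> plus a tail; as \<open>Im b = 1\<close>,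
  the imaginary part isolates \<open>e\<^sub>0\<close>.\<close>

lemma abs_leading_digit_le:
  assumes n: "n \<ge> 1" and e: "\<And>j. \<bar>e j\<bar> \<le> B" and z: "radix_sum (inverse (base n)) e = 0"
  shows "of_int \<bar>e 0\<bar> * (norm (base n) - 1)\<^sup>2 \<le> of_int B"
proof -
  define w where "w = inverse (base n)"
  have w1: "norm w < 1" unfolding w_def using n by (rule norm_inverse_base_less_1)
  define t where "t = radix_sum w (\<lambda>j. e (j + 2))"
  have "0 = of_int (e 0) * w + of_int (e 1) * w ^ 2 + w ^ 2 * t"
    using radix_sum_split[of w e B 2, OF w1 e] z by (simp add: w_def t_def numeral_2_eq_2)
  also have "\<dots> = w ^ 2 * (of_int (e 0) * base n + of_int (e 1) + t)"
    by (simp add: w_def field_simps power2_eq_square base_nz)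
  finally have "of_int (e 0) * base n + of_int (e 1) + t = 0"
    by (simp add: w_def base_nz)
  hence "Im (of_int (e 0) * base n + of_int (e 1) + t) = 0" by simp
  hence "of_int \<bar>e 0\<bar> = \<bar>Im t\<bar>"
    by (simp add: base_def)
  also have "\<dots> \<le> of_int B * \<bar>Im w\<bar> / (1 - norm w)\<^sup>2"
    unfolding t_def by (rule abs_Im_radix_sum_le[OF w1]) (rule e)
  \<comment> \<open>w is the conjugate of b divided by |b|^2, and Im b = 1.\<close>
  also have "\<bar>Im w\<bar> = 1 / (norm (base n))\<^sup>2"
    by (simp add: w_def norm_base) (simp add: base_def)
  also have "1 - norm w = (norm (base n) - 1) / norm (base n)"
    using base_nz[of n] by (simp add: w_def norm_inverse diff_divide_distrib inverse_eq_divide[of "norm _"])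
  also have "of_int B * (1 / (norm (base n))\<^sup>2) / ((norm (base n) - 1) / norm (base n))\<^sup>2
      = of_int B / (norm (base n) - 1)\<^sup>2"
    using base_nz[of n] by (simp add: power_divide)
  finally show ?thesis
    using norm_base_gt_1[OF n] by (simp add: field_simps)
qed

definition unique_expansions :: "complex \<Rightarrow> int set \<Rightarrow> bool" where
  "unique_expansions w E \<longleftrightarrow>
     (\<forall>e f. (\<forall>j. e j \<in> E) \<longrightarrow> (\<forall>j. f j \<in> E) \<longrightarrow> radix_sum w e = radix_sum w f \<longrightarrow> e = f)"

text \<open>By shifting, uniqueness need only be checked at the leading digit.\<close>

lemma unique_expansionsI:
  assumes w: "norm w < 1" "w \<noteq> 0" and B: "\<And>d. d \<in> E \<Longrightarrow> \<bar>d\<bar> \<le> B"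
    and lead: "\<And>e f. (\<And>j. e j \<in> E) \<Longrightarrow> (\<And>j. f j \<in> E) \<Longrightarrow> radix_sum w (\<lambda>j. e j - f j) = 0 \<Longrightarrow> e 0 = f 0"
  shows "unique_expansions w E"
  unfolding unique_expansions_def
proof (intro allI impI)
  fix e f assume e: "\<forall>j. e j \<in> E" and f: "\<forall>j. f j \<in> E" and eq: "radix_sum w e = radix_sum w f"
  define g where "g = (\<lambda>j. e j - f j)"
  have z: "radix_sum w g = 0"
    using radix_sum_diff[OF w(1), of e B f] B e f eq by (simp add: g_def)
  have gB: "\<bar>g j\<bar> \<le> 2 * B" for j
    using B[of "e j"] B[of "f j"] e f by (auto simp: g_def)
  have "g k = 0" for k
  proof (induction k rule: less_induct)
    case (less k)
    \<comment> \<open>By induction the digits of \<open>g\<close> before k vanish, so the finite sum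
      in the splitting drops out.\<close>
    have "radix_sum w g = w ^ k * radix_sum w (\<lambda>j. g (j + k))"
      using radix_sum_split[of w g "2 * B" k, OF w(1) gB] less by simp
    hence "radix_sum w (\<lambda>j. g (j + k)) = 0" using z w(2) by simp
    hence "e (0 + k) = f (0 + k)"
      using lead[of "\<lambda>j. e (j + k)" "\<lambda>j. f (j + k)"] e f by (simp add: g_def)
    thus ?case by (simp add: g_def)
  qed
  thus "e = f" by (auto simp: g_def fun_eq_iff)
qed

text \<open>Two expansions of one point have a digit difference bounded by 2B, so its leading digit
  times (|b| - 1)^2 is at most 2B in modulus. A nonzero leading digit is at least m in modulus,
  contradicting \<open>less\<close>.\<close>

lemma unique_expansions_of_separated:
  assumes n: "n \<ge> 1" and B: "\<And>d. d \<in> E \<Longrightarrow> \<bar>d\<bar> \<le> B"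
    and sep: "\<And>d d'. d \<in> E \<Longrightarrow> d' \<in> E \<Longrightarrow> d \<noteq> d' \<Longrightarrow> \<bar>d - d'\<bar> \<ge> m"
    and less: "real_of_int (2 * B) < of_int m * (norm (base n) - 1)\<^sup>2"
  shows "unique_expansions (inverse (base n)) E"
proof (rule unique_expansionsI[OF norm_inverse_base_less_1[OF n] _ B])
  fix e f assume e: "\<And>j. e j \<in> E" and f: "\<And>j. f j \<in> E"
    and z: "radix_sum (inverse (base n)) (\<lambda>j. e j - f j) = 0"
  have "\<bar>e j - f j\<bar> \<le> 2 * B" for j
    using B[OF e[of j]] B[OF f[of j]] by linarith
  from abs_leading_digit_le[OF n this z]
  have le: "of_int \<bar>e 0 - f 0\<bar> * (norm (base n) - 1)\<^sup>2 \<le> of_int (2 * B)" .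
  show "e 0 = f 0"
  proof (rule ccontr)
    assume "e 0 \<noteq> f 0"
    hence "of_int m * (norm (base n) - 1)\<^sup>2 \<le> of_int \<bar>e 0 - f 0\<bar> * (norm (base n) - 1)\<^sup>2"
      using sep[OF e f] by (intro mult_right_mono) (simp_all del: of_int_abs of_int_diff)
    thus False using le less by linarith
  qed
qed (simp_all add: base_nz)

text \<open>For \<open>n = 2\<close> the bound on the leading digit just fails, but the remainder
  \<open>b\<^sup>2 e\<^sub>0 + b e\<^sub>1 + e\<^sub>2\<close> of a vanishing expansion with \<open>\<bar>e\<^sub>j\<bar> \<le> 2\<close>
  has modulus at most \<open>2 / (\<surd>5 - 1) < 2\<close>, and its imaginary part is \<open>e\<^sub>1 - 4 e\<^sub>0\<close>.\<close>

lemma unique_expansions_base_2: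
  assumes "c > 0" and E: "E \<subseteq> {- c, 0, c}"
  shows "unique_expansions (inverse (base 2)) E"
proof (rule unique_expansionsI)
  let ?w = "inverse (base 2)"
  show w1: "norm ?w < 1" by (rule norm_inverse_base_less_1) simp
  show "?w \<noteq> 0" by (simp add: base_nz)
  show "\<bar>d\<bar> \<le> c" if "d \<in> E" for d using that E assms(1) by auto
  fix e f assume e: "\<And>j. e j \<in> E" and f: "\<And>j. f j \<in> E"
    and z: "radix_sum ?w (\<lambda>j. e j - f j) = 0"
  \<comment> \<open>Dividing by c leaves digits in {-2,...,2}, whatever c is.\<close>
  have "\<exists>u. e j - f j = c * u \<and> \<bar>u\<bar> \<le> 2" for j
  proof -
    have "e j \<in> {-c,0,c}" "f j \<in> {-c,0,c}" using e f E by auto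
    hence "e j - f j \<in> {c*(-2), c*(-1), c*0, c*1, c*2}" by auto
    thus ?thesis by fastforce
  qed
  then obtain u where u: "\<And>j. e j - f j = c * u j" and u2: "\<And>j. \<bar>u j\<bar> \<le> 2" by metis
  have "radix_sum ?w (\<lambda>j. e j - f j) = of_int c * radix_sum ?w u"
    unfolding radix_sum_def u of_int_mult mult.assoc
    by (rule suminf_mult[OF summable_radix[OF w1 u2]])
  hence zu: "radix_sum ?w u = 0" using z assms(1) by simp
  define b where "b = base 2"
  have bw: "b * ?w = 1" by (simp add: b_def base_nz)
  \<comment> \<open>The geometric bound is 2 / (sqrt 5 - 1), below 2 because sqrt 5 > 2.\<close>
  have rho: "norm (radix_sum ?w (\<lambda>j. u (j + k))) < 2" for k
  proof -
    have s: "sqrt 5 > 2" by (rule real_less_rsqrt) simp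
    have "norm (radix_sum ?w (\<lambda>j. u (j + k))) \<le> of_int 2 * (norm ?w / (1 - norm ?w))"
      by (rule norm_radix_sum_le[OF w1 u2])
    also have "norm ?w = 1 / sqrt 5" by (simp add: norm_inverse norm_base divide_inverse)
    also have "of_int 2 * (1 / sqrt 5 / (1 - 1 / sqrt 5)) = 2 / (sqrt 5 - 1)"
      using s by (simp add: divide_simps)
    also have "\<dots> < 2" using s by (simp add: field_simps)
    finally show ?thesis .
  qed
  \<comment> \<open>Multiplying the vanishing expansion by b^k turns its first k terms into a
    polynomial in b, which must be minus the remaining tail.\<close>
  have rem: "norm (\<Sum>j<k. of_int (u j) * b ^ (k - Suc j)) < 2" for k
  proof -
    have "0 = b ^ k * radix_sum ?w u" using zu by simp
    also have "\<dots> = (\<Sum>j<k. of_int (u j) * (b ^ k * ?w ^ Suc j)) + (b ^ k * ?w ^ k) * radix_sum ?w (\<lambda>j. u (j + k))"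
      by (subst radix_sum_split[of ?w u 2 k, OF w1 u2])
        (simp add: distrib_left sum_distrib_left mult.left_commute mult.assoc del: power_inverse)
    also have "b ^ k * ?w ^ k = 1" by (simp add: bw flip: power_mult_distrib)
    also have "(\<Sum>j<k. of_int (u j) * (b ^ k * ?w ^ Suc j)) = (\<Sum>j<k. of_int (u j) * b ^ (k - Suc j))"
    proof (rule sum.cong[OF refl])
      fix j assume "j \<in> {..<k}"
      hence "b ^ k = b ^ (k - Suc j) * b ^ Suc j" by (simp flip: power_add power_Suc)
      moreover have "b ^ Suc j * ?w ^ Suc j = 1" by (simp only: bw power_one flip: power_mult_distrib)
      ultimately have "b ^ k * ?w ^ Suc j = b ^ (k - Suc j)" by (simp only: mult.assoc mult_1_right)
      thus "of_int (u j) * (b ^ k * ?w ^ Suc j) = of_int (u j) * b ^ (k - Suc j)" by simp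
    qed
    finally have "(\<Sum>j<k. of_int (u j) * b ^ (k - Suc j)) = - radix_sum ?w (\<lambda>j. u (j + k))"
      by (simp add: eq_neg_iff_add_eq_0)
    thus ?thesis using rho by simp
  qed
  have b: "b = Complex (-2) 1" by (simp add: b_def base_def complex_eq_iff)
  \<comment> \<open>Here b^2 = 3 - 4i and Im b = 1.\<close>
  have s2: "Im (\<Sum>j<3. of_int (u j) * b ^ (3 - Suc j)) = of_int (u 1 - 4 * u 0)"
    by (simp add: numeral_3_eq_3 b)
  have 2: "\<bar>u 1 - 4 * u 0\<bar> < 2"
    using le_less_trans[OF abs_Im_le_cmod rem[of 3]] unfolding s2 by linarith
  \<comment> \<open>|4 u_0| < 2 + |u_1| <= 4 forces the integer u_0 to be 0.\<close>
  have "u 0 = 0" using 2 u2[of 1] by linarith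
  thus "e 0 = f 0" using u[of 0] by simp
qed

section \<open>Covering numbers and box dimension along geometric scales\<close>

lemma cover_num_le:
  assumes "finite T" "A \<subseteq> (\<Union>t\<in>T. cball t r)"
  shows "cover_num A r \<le> card T"
  unfolding cover_num_def by (rule cInf_lower) (use assms in auto)

text \<open>The cover S makes the set of cardinalities nonempty, so its infimum in the naturals is
  attained.\<close>

lemma cover_num_obtains:
  assumes "finite S" "A \<subseteq> (\<Union>t\<in>S. cball t r)"
  obtains T where "finite T" "A \<subseteq> (\<Union>t\<in>T. cball t r)" "card T = cover_num A r"
proof -
  have "cover_num A r \<in> {card T | T. finite T \<and> A \<subseteq> (\<Union>t\<in>T. cball t r)}"
    unfolding cover_num_def by (rule Inf_nat_def1) (use assms in auto)
  thus ?thesis using that by auto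
qed

lemma cover_num_antimono:
  assumes "r \<le> r'" "finite S" "A \<subseteq> (\<Union>t\<in>S. cball t r)"
  shows "cover_num A r' \<le> cover_num A r"
proof -
  obtain T where T: "finite T" "A \<subseteq> (\<Union>t\<in>T. cball t r)" "card T = cover_num A r"
    using cover_num_obtains[OF assms(2,3)] .
  have "A \<subseteq> (\<Union>t\<in>T. cball t r')"
    using T(2) subset_cball[OF assms(1)] by blast
  thus ?thesis using cover_num_le[OF T(1)] T(3) by metis
qed

text \<open>A ball of radius r holds at most one point of Q, so sending each point to the centre of
  a ball containing it is injective.\<close>

lemma card_separated_le_cover_num:
  assumes "finite S" "A \<subseteq> (\<Union>t\<in>S. cball t r)"
    and Q: "Q \<subseteq> A" and sep: "\<And>x y. x \<in> Q \<Longrightarrow> y \<in> Q \<Longrightarrow> x \<noteq> y \<Longrightarrow> dist x y > 2 * r"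
  shows "card Q \<le> cover_num A r"
proof -
  obtain T where T: "finite T" "A \<subseteq> (\<Union>t\<in>T. cball t r)" "card T = cover_num A r"
    using cover_num_obtains[OF assms(1,2)] .
  have "\<forall>x\<in>Q. \<exists>t\<in>T. x \<in> cball t r" using T(2) Q by blast
  then obtain h where h: "\<And>x. x \<in> Q \<Longrightarrow> h x \<in> T" "\<And>x. x \<in> Q \<Longrightarrow> dist (h x) x \<le> r"
    by (metis mem_cball)
  have "inj_on h Q"
  proof (rule inj_onI, rule ccontr)
    fix x y assume xy: "x \<in> Q" "y \<in> Q" "h x = h y" "x \<noteq> y"
    have "dist x y \<le> dist (h x) x + dist (h y) y"
      using xy(3) by (metis dist_triangle3 dist_commute)
    thus False using h(2)[OF xy(1)] h(2)[OF xy(2)] sep[OF xy(1,2,4)] by linarith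
  qed
  hence "card Q \<le> card T" using h(1) T(1) by (intro card_inj_on_le[of h]) auto
  thus ?thesis using T(3) by simp
qed

text \<open>Factor a(g s)/s as (a(g s)/g s)(g s/s). This passes from the discrete level k to the
  continuous scale s = -ln r.\<close>

lemma tendsto_comp_over_id:
  fixes a :: "nat \<Rightarrow> real" and g :: "real \<Rightarrow> nat"
  assumes a: "(\<lambda>k. a k / real k) \<longlonglongrightarrow> L" and g: "filterlim g at_top at_top"
    and gs: "((\<lambda>s. real (g s) / s) \<longlongrightarrow> c) at_top"
  shows "((\<lambda>s. a (g s) / s) \<longlongrightarrow> L * c) at_top"
proof (rule Lim_transform_eventually)
  show "((\<lambda>s. a (g s) / real (g s) * (real (g s) / s)) \<longlongrightarrow> L * c) at_top"
    by (intro tendsto_mult gs filterlim_compose[OF a g])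
  have "eventually (\<lambda>s. g s \<ge> 1) at_top" using g by (simp add: filterlim_at_top)
  thus "eventually (\<lambda>s. a (g s) / real (g s) * (real (g s) / s) = a (g s) / s) at_top"
    by eventually_elim simp
qed

text \<open>The same M k bounds the covering number from above at radius c/\<rho>^k and from below
  at c'/\<rho>^k. The constants shift the logarithmic scale by a bounded amount only, which
  disappears in the limit.\<close>

lemma has_box_dim_geometric:
  fixes A :: "'a::metric_space set"
  assumes rho: "\<rho> > 1" and c: "c > 0" "c' > 0" and bA: "bounded A" "A \<noteq> {}"
    and M: "\<And>k. M k > 0"
    and upper: "\<And>k. \<exists>T. finite T \<and> card T \<le> M k \<and> A \<subseteq> (\<Union>t\<in>T. cball t (c / \<rho> ^ k))"
    and lower: "\<And>k. \<exists>Q\<subseteq>A. M k \<le> card Q \<and> (\<forall>x\<in>Q. \<forall>y\<in>Q. x \<noteq> y \<longrightarrow> dist x y > 2 * (c' / \<rho> ^ k))"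
    and lim: "(\<lambda>k. ln (real (M k)) / real k) \<longlonglongrightarrow> L"
  shows "has_box_dim A (L / ln \<rho>)"
proof -
  define v where "v = ln \<rho>"
  have v: "v > 0" using rho by (simp add: v_def)
  have exp_v: "\<rho> ^ k = exp (real k * v)" for k
    using rho by (simp add: v_def exp_of_nat_mult)
  define N where "N r = cover_num A r" for r
  have ex: "\<exists>k. c / \<rho> ^ k \<le> r" if "r > 0" for r
  proof -
    obtain k where "c / r < \<rho> ^ k" using rho real_arch_pow by blast
    hence "c / \<rho> ^ k \<le> r" using that rho by (simp add: field_simps)
    thus ?thesis ..
  qed
  have fin: "\<exists>S. finite S \<and> A \<subseteq> (\<Union>t\<in>S. cball t r)" if r: "r > 0" for r
  proof -
    obtain k where k: "c / \<rho> ^ k \<le> r" using ex[OF r] by blast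
    obtain T where "finite T" "A \<subseteq> (\<Union>t\<in>T. cball t (c / \<rho> ^ k))" using upper by blast
    thus ?thesis using subset_cball[OF k] by (intro exI[of _ T]) blast
  qed
  have anti: "N r' \<le> N r" if "0 < r" "r \<le> r'" for r r'
    using fin[OF that(1)] that(2) cover_num_antimono unfolding N_def by blast
  have up: "N (c / \<rho> ^ k) \<le> M k" for k
  proof -
    obtain T where "finite T" "card T \<le> M k" "A \<subseteq> (\<Union>t\<in>T. cball t (c / \<rho> ^ k))" using upper by blast
    thus ?thesis using cover_num_le[of T A "c / \<rho> ^ k"] by (simp add: N_def)
  qed
  have low: "M k \<le> N (c' / \<rho> ^ k)" for k
  proof -
    have "c' / \<rho> ^ k > 0" using c rho by simp
    then obtain S where "finite S" "A \<subseteq> (\<Union>t\<in>S. cball t (c' / \<rho> ^ k))" using fin by blast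
    moreover obtain Q where "Q \<subseteq> A" "M k \<le> card Q"
      "\<forall>x\<in>Q. \<forall>y\<in>Q. x \<noteq> y \<longrightarrow> dist x y > 2 * (c' / \<rho> ^ k)" using lower[of k] by auto
    ultimately have "card Q \<le> N (c' / \<rho> ^ k)"
      unfolding N_def by (intro card_separated_le_cover_num[of S]) blast+
    thus ?thesis using \<open>M k \<le> card Q\<close> by (rule le_trans[rotated])
  qed
  \<comment> \<open>For large s, g s is the last level with c'/\<rho>^k >= exp(-s), and h s is the
    first with c/\<rho>^k <= exp(-s).\<close>
  define g where "g s = nat \<lfloor>(s + ln c') / v\<rfloor>" for s
  define h where "h s = nat \<lceil>(s + ln c) / v\<rceil>" for s
  have g_top: "filterlim g at_top at_top" and h_top: "filterlim h at_top at_top"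
    unfolding g_def h_def using v by real_asymp+
  have gs: "((\<lambda>s. real (g s) / s) \<longlongrightarrow> inverse v) at_top" and hs: "((\<lambda>s. real (h s) / s) \<longlongrightarrow> inverse v) at_top"
    unfolding g_def h_def using v by real_asymp+
  have lb: "eventually (\<lambda>s. ln (real (M (g s))) / s \<le> ln (real (N (exp (- s)))) / s) at_top"
    \<comment> \<open>s >= -ln c' keeps \<open>nat\<close> from truncating a negative floor; s >= 1
      allows division by s.\<close>
    using eventually_ge_at_top[of "max 1 (- ln c')"]
  proof eventually_elim
    case (elim s)
    have "real (g s) \<le> (s + ln c') / v" unfolding g_def using elim v by (simp add: of_nat_floor)
    hence "real (g s) * v \<le> s + ln c'" using v by (simp add: field_simps)
    hence "exp (real (g s) * v) \<le> exp s * c'" using c by (metis exp_add exp_le_cancel_iff exp_ln)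
    hence "exp (- s) \<le> c' / \<rho> ^ g s" by (simp add: exp_v exp_minus field_simps)
    hence "M (g s) \<le> N (exp (- s))"
      using anti[of "exp (-s)" "c' / \<rho> ^ g s"] low[of "g s"] by simp
    thus ?case using M[of "g s"] elim by (intro divide_right_mono) auto
  qed
  have ub: "eventually (\<lambda>s. ln (real (N (exp (- s)))) / s \<le> ln (real (M (h s))) / s) at_top"
    using eventually_ge_at_top[of "max 1 (- ln c')"]
  proof eventually_elim
    case (elim s)
    have "real (h s) \<ge> (s + ln c) / v" unfolding h_def by linarith
    hence "real (h s) * v \<ge> s + ln c" using v by (simp add: field_simps)
    hence "exp (real (h s) * v) \<ge> exp s * c" using c by (metis exp_add exp_le_cancel_iff exp_ln)
    hence "exp (- s) \<ge> c / \<rho> ^ h s" by (simp add: exp_v exp_minus field_simps)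
    moreover have "c / \<rho> ^ h s > 0" using c rho by simp
    ultimately have "N (exp (- s)) \<le> M (h s)"
      using anti up le_trans by blast
    \<comment> \<open>Monotonicity of \<open>ln\<close> is applied at this number, so it must be
      positive; an empty cover is excluded by A being nonempty.\<close>
    moreover have "N (exp (- s)) > 0"
    proof -
      obtain T where "finite T" "A \<subseteq> (\<Union>t\<in>T. cball t (exp (- s)))" "card T = N (exp (- s))"
        using fin[of "exp (- s)"] cover_num_obtains unfolding N_def by (metis exp_gt_zero)
      thus ?thesis using bA(2) by (metis SUP_bot card_gt_0_iff image_empty subset_empty Union_empty)
    qed
    ultimately show ?case using elim by (intro divide_right_mono) auto
  qed
  have "((\<lambda>s. ln (real (N (exp (- s)))) / s) \<longlongrightarrow> L * inverse v) at_top"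
    by (rule tendsto_sandwich[OF lb ub tendsto_comp_over_id[OF lim g_top gs] tendsto_comp_over_id[OF lim h_top hs]])
  moreover have "filterlim (\<lambda>r::real. - ln r) at_top (at_right 0)" by real_asymp
  ultimately have "((\<lambda>r. ln (real (N (exp (- (- ln r))))) / (- ln r)) \<longlongrightarrow> L / v) (at_right 0)"
    unfolding divide_inverse[of L] by (rule filterlim_compose)
  hence "((\<lambda>r. ln (real (N r)) / (- ln r)) \<longlongrightarrow> L / v) (at_right 0)"
    by (rule Lim_transform_eventually)
       (simp add: eventually_at_right_less eventually_mono[OF eventually_at_right_less])
  hence lim0: "((\<lambda>r. ereal (ln (real (cover_num A r)) / (- ln r))) \<longlongrightarrow> ereal (L / v)) (at_right 0)"
    unfolding N_def by (rule tendsto_ereal)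
  have "upper_box_dim A = ereal (L / v)" "lower_box_dim A = ereal (L / v)"
    unfolding upper_box_dim_def lower_box_dim_def
    by (rule lim_imp_Limsup[OF _ lim0] lim_imp_Liminf[OF _ lim0], simp)+
  thus ?thesis using bA by (simp add: has_box_dim_def v_def)
qed

section \<open>Box dimension of sets given by digit restrictions\<close>

text \<open>Horner's scheme z -> b z + e_k preserves Gaussian integers. If b z + e_k = 0, then n^2 +
  1 divides e_k, so the digit bound n^2 forces e_k = 0 and z = 0.\<close>

lemma partial_radix_sum_gaussian:
  fixes n :: nat
  defines "w \<equiv> inverse (base n)"
  assumes e: "\<And>j. \<bar>e j\<bar> \<le> int (n\<^sup>2)"
  shows "\<exists>p q :: int. (\<Sum>j<k. of_int (e j) * w ^ Suc j) = w ^ k * Complex (of_int p) (of_int q) \<and>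
           (p = 0 \<and> q = 0 \<longrightarrow> (\<forall>j<k. e j = 0))"
proof (induction k)
  case 0
  show ?case by (intro exI[of _ 0]) (simp add: complex_eq_iff)
next
  case (Suc k)
  then obtain p q where pq: "(\<Sum>j<k. of_int (e j) * w ^ Suc j) = w ^ k * Complex (of_int p) (of_int q)"
    and imp: "p = 0 \<and> q = 0 \<longrightarrow> (\<forall>j<k. e j = 0)" by blast
  let ?p = "e k - int n * p - q" and ?q = "p - int n * q"
  have "w ^ k = w ^ Suc k * base n" by (simp add: w_def base_nz)
  hence "(\<Sum>j<Suc k. of_int (e j) * w ^ Suc j) =
      w ^ Suc k * (base n * Complex (of_int p) (of_int q) + of_int (e k))"
    using pq by (simp add: algebra_simps del: power_Suc)
  also have "base n * Complex (of_int p) (of_int q) + of_int (e k) = Complex (of_int ?p) (of_int ?q)"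
    by (simp add: base_def complex_eq_iff algebra_simps)
  finally have "(\<Sum>j<Suc k. of_int (e j) * w ^ Suc j) = w ^ Suc k * Complex (of_int ?p) (of_int ?q)" .
  moreover have "\<forall>j<Suc k. e j = 0" if "?p = 0" "?q = 0"
  proof -
    \<comment> \<open>The imaginary part gives p = n q; substituted in the real part, it gives e_k =
      (n^2 + 1) q.\<close>
    have p: "p = int n * q" using that(2) by simp
    hence ek: "e k = (int (n\<^sup>2) + 1) * q" using that(1) by (simp add: algebra_simps power2_eq_square)
    have "q = 0"
    proof (rule ccontr)
      assume "q \<noteq> 0"
      hence "(int (n\<^sup>2) + 1) * 1 \<le> (int (n\<^sup>2) + 1) * \<bar>q\<bar>" by (intro mult_left_mono) auto
      also have "\<dots> = \<bar>e k\<bar>" by (simp add: ek abs_mult)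
      finally show False using e[of k] by simp
    qed
    thus ?thesis using p ek imp by (auto simp: less_Suc_eq)
  qed
  ultimately show ?case by blast
qed

lemma norm_Complex_of_int_ge_1:
  assumes "p \<noteq> 0 \<or> q \<noteq> 0"
  shows "norm (Complex (of_int p) (of_int q)) \<ge> 1"
proof -
  let ?z = "Complex (of_int p) (of_int q)"
  have "\<bar>p\<bar> \<ge> 1 \<or> \<bar>q\<bar> \<ge> 1" using assms by linarith
  hence "\<bar>Re ?z\<bar> \<ge> 1 \<or> \<bar>Im ?z\<bar> \<ge> 1" unfolding complex.sel by linarith
  thus ?thesis using abs_Re_le_cmod[of ?z] abs_Im_le_cmod[of ?z] by linarith
qed

text \<open>The allowed digits depend on the position, so that both the attractor (constant A) and
  the sets C(\<alpha>) have this form.\<close>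

definition digit_set :: "complex \<Rightarrow> (nat \<Rightarrow> int set) \<Rightarrow> complex set" where
  "digit_set w A = {radix_sum w a | a. \<forall>j. a j \<in> A j}"

lemma Cset_eq_digit_set:
  assumes "n \<ge> 1" "D \<subseteq> {0 .. int (n\<^sup>2)}"
  shows "Cset n D = digit_set (inverse (base n)) (\<lambda>_. D)"
proof -
  have "(\<lambda>j. of_int (d j) * inverse (base n) ^ Suc j) sums x \<longleftrightarrow> x = radix_sum (inverse (base n)) d"
    if "\<forall>j. d j \<in> D" for d x
  proof -
    have "\<bar>d j\<bar> \<le> int (n\<^sup>2)" for j
      using that[rule_format, of j] assms(2) by auto
    from radix_sums[OF norm_inverse_base_less_1[OF assms(1)], of d, OF this]
    show ?thesis by (auto intro: sums_unique2)
  qed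
  thus ?thesis unfolding Cset_def digit_set_def by blast
qed

text \<open>There are M k admissible words of length k. Their truncated sums are centres of balls of
  radius c|w|^k covering the set, while points with distinct words and a common tail differ by w^k
  times a nonzero Gaussian integer.\<close>

lemma has_box_dim_digit_set:
  fixes n :: nat
  defines "w \<equiv> inverse (base n)"
  assumes n: "n \<ge> 1" and A: "\<And>j. A j \<subseteq> {0 .. int (n\<^sup>2)}" "\<And>j. A j \<noteq> {}"
    and lim: "(\<lambda>k. (\<Sum>j<k. ln (real (card (A j)))) / real k) \<longlonglongrightarrow> L"
  shows "has_box_dim (digit_set w A) (L / ln (norm (base n)))"
proof -
  let ?N = "int (n\<^sup>2)"
  define \<rho> where "\<rho> = norm (base n)"
  have rho: "\<rho> > 1" using norm_base_gt_1[OF n] by (simp add: \<rho>_def)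
  have w1: "norm w < 1" unfolding w_def by (rule norm_inverse_base_less_1[OF n])
  have w0: "norm w > 0" by (simp add: w_def base_nz)
  have wk: "norm w ^ k = 1 / \<rho> ^ k" for k
    by (simp add: w_def \<rho>_def norm_inverse divide_inverse power_inverse)
  have fin: "finite (A j)" for j by (rule finite_subset[OF A(1)]) simp
  have dig: "\<bar>x\<bar> \<le> ?N" if "x \<in> A j" for x j
    using A(1)[of j] that by auto
  define c where "c = of_int ?N * (norm w / (1 - norm w))"
  have c: "c > 0" using n w0 w1 by (simp add: c_def)
  define M where "M k = (\<Prod>j<k. card (A j))" for k
  have cA: "card (A j) > 0" for j using fin A(2) by (simp add: card_gt_0_iff)
  have M: "M k > 0" for k unfolding M_def using cA by (simp add: prod_pos)
  have lnM: "ln (real (M k)) = (\<Sum>j<k. ln (real (card (A j))))" for k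
  proof -
    have "real (card (A j)) \<noteq> 0" for j using cA[of j] by simp
    thus ?thesis unfolding M_def of_nat_prod by (intro ln_prod) blast
  qed
  have cardP: "card (PiE {..<k} A) = M k" for k by (simp add: card_PiE M_def)
  have finP: "finite (PiE {..<k} A)" for k by (rule finite_PiE) (use fin in auto)
  have "\<forall>j. \<exists>x. x \<in> A j" using A(2) by blast
  then obtain t where t: "\<And>j. t j \<in> A j" by metis
  show ?thesis
    unfolding \<rho>_def[symmetric]
  \<comment> \<open>Any constant below 1/2 would serve: points are |w|^k apart and the criterion
    asks for more than 2c'|w|^k.\<close>
  proof (rule has_box_dim_geometric[OF rho c, of "1/3"])
    show "digit_set w A \<noteq> {}" using t by (auto simp: digit_set_def)
    have "norm (radix_sum w a) \<le> c" if "\<forall>j. a j \<in> A j" for a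
      unfolding c_def by (rule norm_radix_sum_le[OF w1]) (use that dig in blast)
    thus "bounded (digit_set w A)" unfolding bounded_iff digit_set_def by blast
    show "M k > 0" for k by (rule M)
    show "(\<lambda>k. ln (real (M k)) / real k) \<longlonglongrightarrow> L" unfolding lnM by (rule lim)
    fix k
    define T where "T = (\<lambda>a. \<Sum>j<k. of_int (a j) * w ^ Suc j) ` PiE {..<k} A"
    have cover: "digit_set w A \<subseteq> (\<Union>t\<in>T. cball t (c / \<rho> ^ k))"
    proof
      fix x assume "x \<in> digit_set w A"
      then obtain a where a: "\<And>j. a j \<in> A j" and x: "x = radix_sum w a"
        by (auto simp: digit_set_def)
      let ?p = "\<Sum>j<k. of_int (restrict a {..<k} j) * w ^ Suc j"
      have "x = ?p + w ^ k * radix_sum w (\<lambda>j. a (j + k))"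
        unfolding x using radix_sum_split[of w a ?N k, OF w1] dig[OF a] by simp
      hence "dist ?p x = norm w ^ k * norm (radix_sum w (\<lambda>j. a (j + k)))"
        by (simp add: dist_norm norm_mult norm_power)
      also have "\<dots> \<le> norm w ^ k * c"
        unfolding c_def by (intro mult_left_mono norm_radix_sum_le[OF w1] dig[OF a]) simp
      finally have "x \<in> cball ?p (c / \<rho> ^ k)" by (simp add: wk)
      moreover have "?p \<in> T"
        unfolding T_def by (rule imageI) (simp only: restrict_PiE_iff a ball_triv simp_thms)
      ultimately show "x \<in> (\<Union>t\<in>T. cball t (c / \<rho> ^ k))" by blast
    qed
    have T: "finite T" "card T \<le> M k"
      unfolding T_def using finP[of k] card_image_le[OF finP[of k]] cardP[of k] by auto
    show "\<exists>T. finite T \<and> card T \<le> M k \<and> digit_set w A \<subseteq> (\<Union>t\<in>T. cball t (c / \<rho> ^ k))"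
      using T cover by blast
  next
    fix k
    \<comment> \<open>All words receive the same tail t, so the difference of two representatives is
      a finite sum of k terms.\<close>
    define ext where "ext a j = (if j < k then a j else t j)" for a :: "nat \<Rightarrow> int" and j
    have ext: "ext a j \<in> A j" if "a \<in> PiE {..<k} A" for a j
      using that t by (auto simp: ext_def PiE_mem)
    define Q where "Q = (\<lambda>a. radix_sum w (ext a)) ` PiE {..<k} A"
    have sep: "dist (radix_sum w (ext a)) (radix_sum w (ext a')) \<ge> 1 / \<rho> ^ k"
      if a: "a \<in> PiE {..<k} A" and a': "a' \<in> PiE {..<k} A" and ne: "a \<noteq> a'" for a a'
    proof -
      define e where "e j = ext a j - ext a' j" for j
      have e: "\<bar>e j\<bar> \<le> ?N" for j
        using subsetD[OF A(1) ext[OF a, of j]] subsetD[OF A(1) ext[OF a', of j]] by (auto simp: e_def)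
      have e0: "e (j + k) = 0" for j by (simp add: e_def ext_def)
      have diff: "radix_sum w (ext a) - radix_sum w (ext a') = radix_sum w e"
        unfolding e_def by (rule radix_sum_diff[symmetric, OF w1 dig dig]) (rule ext[OF a] ext[OF a'])+
      have "radix_sum w e = (\<Sum>j<k. of_int (e j) * w ^ Suc j)"
        using radix_sum_split[of w e ?N k, OF w1 e] by (simp add: e0 radix_sum_def[of w "\<lambda>_. 0"])
      moreover obtain p q where pq: "(\<Sum>j<k. of_int (e j) * w ^ Suc j) = w ^ k * Complex (of_int p) (of_int q)"
        and imp: "p = 0 \<and> q = 0 \<longrightarrow> (\<forall>j<k. e j = 0)"
        using partial_radix_sum_gaussian[of e n k, OF e] unfolding w_def by blast
      moreover have "\<not> (\<forall>j<k. e j = 0)"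
      proof
        assume "\<forall>j<k. e j = 0"
        hence "a = a'" by (intro PiE_ext[OF a a']) (auto simp: e_def ext_def)
        thus False using ne by simp
      qed
      ultimately have "norm (radix_sum w e) \<ge> norm w ^ k * 1"
        using norm_Complex_of_int_ge_1[of p q]
        by (auto simp: norm_mult norm_power intro!: mult_left_mono[of 1 _ "norm w ^ k", simplified])
      thus ?thesis by (simp add: dist_norm diff wk)
    qed
    have pos: "1 / \<rho> ^ k > 0" using rho by simp
    have inj: "inj_on (\<lambda>a. radix_sum w (ext a)) (PiE {..<k} A)"
    proof (rule inj_onI, rule ccontr)
      fix a a' assume "a \<in> PiE {..<k} A" "a' \<in> PiE {..<k} A"
        "radix_sum w (ext a) = radix_sum w (ext a')" "a \<noteq> a'"
      thus False using sep[of a a'] pos by simp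
    qed
    have "Q \<subseteq> digit_set w A" using ext by (auto simp: Q_def digit_set_def)
    moreover have "M k \<le> card Q" unfolding Q_def card_image[OF inj] cardP ..
    moreover have "dist x y > 2 * (1 / 3 / \<rho> ^ k)" if "x \<in> Q" "y \<in> Q" "x \<noteq> y" for x y
    proof -
      have "dist x y \<ge> 1 / \<rho> ^ k" using that sep unfolding Q_def by auto
      thus ?thesis using pos by (simp add: field_simps)
    qed
    ultimately show "\<exists>Q\<subseteq>digit_set w A. M k \<le> card Q \<and>
        (\<forall>x\<in>Q. \<forall>y\<in>Q. x \<noteq> y \<longrightarrow> dist x y > 2 * (1 / 3 / \<rho> ^ k))"
      by blast
  qed simp
qed

section \<open>The dimension of the attractor, and sequences of prescribed frequency\<close>

lemma has_box_dim_unique: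
  assumes "has_box_dim A d" "has_box_dim A d'"
  shows "d = d'"
  using assms by (simp add: has_box_dim_def)

lemma box_dim_eq: "has_box_dim A d \<Longrightarrow> box_dim A = d"
  unfolding box_dim_def by (rule the_equality) (auto intro: has_box_dim_unique)

text \<open>Constant digit sets make the Cesaro means constant. This turns the upper limit of the
  range of dimensions into an inequality between logarithms.\<close>

lemma box_dim_Cset:
  assumes "n \<ge> 1" "D \<noteq> {}" "D \<subseteq> {0 .. int (n\<^sup>2)}"
  shows "box_dim (Cset n D) = ln (real (card D)) / ln (norm (base n))"
proof -
  have "(\<lambda>k. (\<Sum>j<k. ln (real (card D))) / real k) \<longlonglongrightarrow> ln (real (card D))"
  proof (rule Lim_transform_eventually[OF tendsto_const])
    show "eventually (\<lambda>k. ln (real (card D)) = (\<Sum>j<k. ln (real (card D))) / real k) sequentially"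
      using eventually_gt_at_top[of 0] by eventually_elim simp
  qed
  from has_box_dim_digit_set[of n "\<lambda>_. D", OF assms(1,3,2) this]
  show ?thesis unfolding Cset_eq_digit_set[OF assms(1,3)] by (rule box_dim_eq)
qed

text \<open>The differences of \<open>\<lfloor>j \<theta>\<rfloor>\<close> form a 0-1 sequence with frequency \<open>\<theta>\<close>.\<close>

lemma ex_sequence_with_frequency:
  fixes \<theta> :: real
  assumes "0 \<le> \<theta>" "\<theta> \<le> 1"
  shows "\<exists>S :: nat set. (\<lambda>k. (\<Sum>j<k. indicator S j) / real k) \<longlonglongrightarrow> \<theta>"
proof -
  define F where "F j = \<lfloor>real j * \<theta>\<rfloor>" for j
  define S where "S = {j. F (Suc j) \<noteq> F j}"
  have ind: "indicator S j = real_of_int (F (Suc j)) - real_of_int (F j)" for j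
  proof -
    have "real (Suc j) * \<theta> = real j * \<theta> + \<theta>" by (simp add: algebra_simps)
    hence "F j \<le> F (Suc j)" "F (Suc j) \<le> F j + 1"
      unfolding F_def using assms by linarith+
    hence "F (Suc j) = F j \<or> F (Suc j) = F j + 1" by linarith
    thus ?thesis by (auto simp: S_def indicator_def)
  qed
  \<comment> \<open>Telescoping gives the floor of k \<theta>, within 1 of k \<theta>.\<close>
  have "(\<Sum>j<k. indicator S j) = real_of_int (F k)" for k
    unfolding ind by (subst sum_lessThan_telescope) (simp add: F_def)
  moreover have "(\<lambda>k. real_of_int (F k) / real k) \<longlonglongrightarrow> \<theta>"
  proof (rule tendsto_sandwich)
    show "(\<lambda>k. \<theta> - 1 / real k) \<longlonglongrightarrow> \<theta>" by real_asymp
    show "eventually (\<lambda>k. \<theta> - 1 / real k \<le> real_of_int (F k) / real k) sequentially"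
      using eventually_gt_at_top[of 0]
    proof eventually_elim
      case (elim k)
      have "\<theta> * real k - 1 \<le> real_of_int (F k)" unfolding F_def by (simp add: mult.commute)
      hence "(\<theta> * real k - 1) / real k \<le> real_of_int (F k) / real k" by (rule divide_right_mono) simp
      thus ?case using elim by (simp add: diff_divide_distrib)
    qed
    show "eventually (\<lambda>k. real_of_int (F k) / real k \<le> \<theta>) sequentially"
      using eventually_gt_at_top[of 0]
    proof eventually_elim
      case (elim k)
      have "real_of_int (F k) \<le> real k * \<theta>" unfolding F_def by simp
      thus ?case using elim by (simp add: field_simps)
    qed
  qed simp
  ultimately have "(\<lambda>k. (\<Sum>j<k. indicator S j) / real k) \<longlonglongrightarrow> \<theta>" by simp
  thus ?thesis ..
qed

text \<open>Finitely many altered terms contribute a constant C, and C/k tends to 0. Hence a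
  prescribed digit prefix does not affect the dimension.\<close>

lemma Cesaro_limit_eventually_eq:
  fixes f g :: "nat \<Rightarrow> real"
  assumes eq: "\<And>j. j \<ge> K \<Longrightarrow> f j = g j"
    and lim: "(\<lambda>k. (\<Sum>j<k. g j) / real k) \<longlonglongrightarrow> L"
  shows "(\<lambda>k. (\<Sum>j<k. f j) / real k) \<longlonglongrightarrow> L"
proof -
  define C where "C = (\<Sum>j<K. f j - g j)"
  have sum: "(\<Sum>j<k. f j) = C + (\<Sum>j<k. g j)" if "k \<ge> K" for k
  proof -
    have "(\<Sum>j<k. f j - g j) = C"
      unfolding C_def by (rule sum.mono_neutral_right) (use that eq in auto)
    thus ?thesis by (simp add: sum_subtractf algebra_simps)
  qed
  have "(\<lambda>k. C / real k + (\<Sum>j<k. g j) / real k) \<longlonglongrightarrow> 0 + L"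
    by (intro tendsto_add lim) real_asymp
  hence "(\<lambda>k. C / real k + (\<Sum>j<k. g j) / real k) \<longlonglongrightarrow> L" by simp
  thus ?thesis
  proof (rule Lim_transform_eventually)
    show "eventually (\<lambda>k. C / real k + (\<Sum>j<k. g j) / real k = (\<Sum>j<k. f j) / real k) sequentially"
      using eventually_ge_at_top[of K] by eventually_elim (simp add: sum add_divide_distrib)
  qed
qed

section \<open>The sets C(\<alpha>) and density of the level sets\<close>

text \<open>If x has digits a and x - \<alpha> has digits a', then a - a' is an expansion of
  \<alpha> over the difference set. Uniqueness makes it \<delta>, so a' = a - \<delta> must lie in D
  at each position.\<close>

lemma Calpha_radix_sum:
  fixes n :: nat
  defines "w \<equiv> inverse (base n)"
  assumes n: "n \<ge> 1" and D: "D \<subseteq> {0 .. int (n\<^sup>2)}"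
    and uniq: "unique_expansions w (diffset D)" and \<delta>: "\<And>j. \<delta> j \<in> diffset D"
  shows "Calpha n D (radix_sum w \<delta>) = digit_set w (\<lambda>j. {d \<in> D. d - \<delta> j \<in> D})"
proof -
  have w1: "norm w < 1" unfolding w_def by (rule norm_inverse_base_less_1[OF n])
  have C: "Cset n D = {radix_sum w a | a. \<forall>j. a j \<in> D}"
    using Cset_eq_digit_set[OF n D] by (simp add: digit_set_def w_def)
  have abs: "\<bar>d\<bar> \<le> int (n\<^sup>2)" if "d \<in> D" for d using that D by auto
  have diff: "radix_sum w (\<lambda>j. a j - a' j) = radix_sum w a - radix_sum w a'"
    if "\<forall>j. a j \<in> D" "\<forall>j. a' j \<in> D" for a a'
    by (rule radix_sum_diff[OF w1, of _ "int (n\<^sup>2)"]) (use that abs in blast)+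
  show ?thesis
  proof (intro equalityI subsetI)
    fix x assume "x \<in> Calpha n D (radix_sum w \<delta>)"
    then obtain a a' where a: "\<forall>j. a j \<in> D" and a': "\<forall>j. a' j \<in> D" and x: "x = radix_sum w a"
      and x': "radix_sum w a = radix_sum w a' + radix_sum w \<delta>"
      by (auto simp: Calpha_def C)
    have "radix_sum w (\<lambda>j. a j - a' j) = radix_sum w \<delta>" using diff[OF a a'] x' by simp
    moreover have "\<forall>j. a j - a' j \<in> diffset D" using a a' by (auto simp: diffset_def)
    ultimately have "(\<lambda>j. a j - a' j) = \<delta>"
      using uniq[unfolded unique_expansions_def, rule_format, of "\<lambda>j. a j - a' j" \<delta>] \<delta> by simp
    from fun_cong[OF this] have "a j - \<delta> j = a' j" for j by (simp add: algebra_simps)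
    thus "x \<in> digit_set w (\<lambda>j. {d \<in> D. d - \<delta> j \<in> D})"
      using a a' x by (auto simp: digit_set_def)
  next
    fix x assume "x \<in> digit_set w (\<lambda>j. {d \<in> D. d - \<delta> j \<in> D})"
    then obtain a where a: "\<forall>j. a j \<in> D" and a': "\<forall>j. a j - \<delta> j \<in> D" and x: "x = radix_sum w a"
      by (auto simp: digit_set_def)
    have "x = radix_sum w (\<lambda>j. a j - \<delta> j) + radix_sum w \<delta>"
      using diff[OF a a'] x by simp
    moreover have "x \<in> Cset n D" "radix_sum w (\<lambda>j. a j - \<delta> j) \<in> Cset n D"
      using a a' x by (auto simp: C)
    ultimately show "x \<in> Calpha n D (radix_sum w \<delta>)"
      unfolding Calpha_def by blast
  qed
qed

lemma Fset_subset_radix_sums: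
  assumes "n \<ge> 1" "D \<subseteq> {0 .. int (n\<^sup>2)}" "\<alpha> \<in> Fset n D"
  obtains \<delta> where "\<And>j. \<delta> j \<in> diffset D" "\<alpha> = radix_sum (inverse (base n)) \<delta>"
proof -
  let ?w = "inverse (base n)"
  obtain a a' where a: "\<forall>j. a j \<in> D" and a': "\<forall>j. a' j \<in> D"
    and eq: "radix_sum ?w a = radix_sum ?w a' + \<alpha>"
  proof -
    obtain x y where "x \<in> Cset n D" "y \<in> Cset n D" "x = y + \<alpha>"
      using assms(3) by (auto simp: Fset_def Calpha_def)
    thus ?thesis
      using that unfolding Cset_eq_digit_set[OF assms(1,2)] digit_set_def by blast
  qed
  have abs: "\<bar>d\<bar> \<le> int (n\<^sup>2)" if "d \<in> D" for d using that assms(2) by auto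
  have "radix_sum ?w (\<lambda>j. a j - a' j) = radix_sum ?w a - radix_sum ?w a'"
    by (rule radix_sum_diff[OF norm_inverse_base_less_1[OF assms(1)], of _ "int (n\<^sup>2)"])
       (use a a' abs in blast)+
  hence "\<alpha> = radix_sum ?w (\<lambda>j. a j - a' j)" using eq by simp
  moreover have "a j - a' j \<in> diffset D" for j using a a' by (auto simp: diffset_def)
  ultimately show ?thesis using that[of "\<lambda>j. a j - a' j"] by simp
qed

lemma abs_diffset_le:
  assumes "D \<subseteq> {0..B}" "\<delta> \<in> diffset D"
  shows "\<bar>\<delta>\<bar> \<le> B"
proof -
  obtain d d' where "\<delta> = d - d'" "d \<in> {0..B}" "d' \<in> {0..B}"
    using assms unfolding diffset_def by blast
  thus ?thesis by auto
qed

lemma level_set_dense: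
  fixes n :: nat
  assumes n: "n \<ge> 1" and D: "D \<noteq> {}" "D \<subseteq> {0 .. int (n\<^sup>2)}"
    and uniq: "unique_expansions (inverse (base n)) (diffset D)"
    and l: "0 \<le> l" "l \<le> box_dim (Cset n D)"
  shows "Fset n D \<subseteq> closure (level_set n D l)"
proof
  fix \<alpha> assume \<alpha>: "\<alpha> \<in> Fset n D"
  define w where "w = inverse (base n)"
  have w1: "norm w < 1" unfolding w_def by (rule norm_inverse_base_less_1[OF n])
  have lnrho: "ln (norm (base n)) > 0" using norm_base_gt_1[OF n] by (rule ln_gt_zero)
  let ?N = "int (n\<^sup>2)"
  have fin: "finite D" by (rule finite_subset[OF D(2)]) simp
  obtain \<delta> where \<delta>: "\<And>j. \<delta> j \<in> diffset D" and \<alpha>_eq: "\<alpha> = radix_sum w \<delta>"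
    using Fset_subset_radix_sums[OF n D(2) \<alpha>] unfolding w_def by blast
  \<comment> \<open>The frequency of full digits that yields dimension l, from \<theta> ln |D| = l
    ln |b|.\<close>
  define \<theta> where "\<theta> = l * ln (norm (base n)) / ln (real (card D))"
  have lle: "l * ln (norm (base n)) \<le> ln (real (card D))"
    using l(2) lnrho unfolding box_dim_Cset[OF n D] by (simp add: pos_le_divide_eq)
  have l0: "0 \<le> l * ln (norm (base n))" using l(1) lnrho by simp
  \<comment> \<open>If |D| = 1, then l ln |b| = 0 as well, and the convention x / 0 = 0 gives
    \<theta> = 0.\<close>
  have \<theta>: "0 \<le> \<theta>" "\<theta> \<le> 1" "\<theta> * ln (real (card D)) = l * ln (norm (base n))"
    using lle l0 by (cases "ln (real (card D)) = 0"; simp add: \<theta>_def)+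
  obtain S :: "nat set" where S: "(\<lambda>k. (\<Sum>j<k. indicator S j) / real k) \<longlonglongrightarrow> \<theta>"
    using ex_sequence_with_frequency[OF \<theta>(1,2)] by blast
  define m where "m = Max D - Min D"
  have MM: "Max D \<in> D" "Min D \<in> D" using fin D(1) by simp_all
  have D0: "{d \<in> D. d - 0 \<in> D} = D" by simp
  \<comment> \<open>Only the pair (Max D, Min D) has difference m, so the digit m leaves one choice
    and contributes ln 1 = 0.\<close>
  have Dm: "{d \<in> D. d - m \<in> D} = {Max D}"
  proof -
    have "d = Max D" if "d \<in> D" "d - m \<in> D" for d
      using Max_ge[OF fin that(1)] Min_le[OF fin that(2)] by (simp add: m_def)
    thus ?thesis using MM by (auto simp: m_def)
  qed
  have mD: "m \<in> diffset D" "0 \<in> diffset D" using MM unfolding m_def diffset_def by fastforce+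
  note absd = abs_diffset_le[OF D(2)]
  define c where "c = of_int ?N * (norm w / (1 - norm w))"
  show "\<alpha> \<in> closure (level_set n D l)"
    unfolding closure_approachable
  proof (intro allI impI)
    fix \<epsilon> :: real assume "\<epsilon> > 0"
    have c: "c \<ge> 0" using w1 by (simp add: c_def)
    \<comment> \<open>Two points with the same first K digits are at most 2c|w|^K apart; the
      \<open>+ 1\<close> keeps the denominator positive.\<close>
    obtain K where K: "norm w ^ K < \<epsilon> / (2 * c + 1)"
      using real_arch_pow_inv[OF _ w1, of "\<epsilon> / (2 * c + 1)"] \<open>\<epsilon> > 0\<close> c by auto
    define \<eta> where "\<eta> j = (if j < K then \<delta> j else if j \<in> S then 0 else m)" for j
    have \<eta>: "\<eta> j \<in> diffset D" for j using \<delta> mD by (simp add: \<eta>_def)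
    define A where "A j = {d \<in> D. d - \<eta> j \<in> D}" for j
    have A0: "A j \<noteq> {}" for j
      using \<eta>[of j] by (force simp: diffset_def A_def)
    have "(\<lambda>k. (\<Sum>j<k. indicator S j) / real k * ln (real (card D))) \<longlonglongrightarrow> \<theta> * ln (real (card D))"
      by (intro tendsto_mult S tendsto_const)
    hence "(\<lambda>k. (\<Sum>j<k. indicator S j * ln (real (card D))) / real k) \<longlonglongrightarrow> l * ln (norm (base n))"
      by (simp add: \<theta>(3) sum_distrib_right)
    hence "(\<lambda>k. (\<Sum>j<k. ln (real (card (A j)))) / real k) \<longlonglongrightarrow> l * ln (norm (base n))"
    proof (rule Cesaro_limit_eventually_eq[rotated])
      fix j assume "K \<le> j"
      thus "ln (real (card (A j))) = indicator S j * ln (real (card D))"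
        using D0 Dm by (auto simp: A_def \<eta>_def indicator_def)
    qed
    hence "has_box_dim (digit_set w A) (l * ln (norm (base n)) / ln (norm (base n)))"
      unfolding w_def by (intro has_box_dim_digit_set[OF n _ A0]) (use D(2) in \<open>auto simp: A_def\<close>)
    hence dim: "has_box_dim (Calpha n D (radix_sum w \<eta>)) l"
      using lnrho Calpha_radix_sum[OF n D(2) uniq \<eta>] by (simp add: w_def A_def[abs_def])
    hence "radix_sum w \<eta> \<in> level_set n D l"
      by (simp add: level_set_def Fset_def has_box_dim_def)
    moreover have "dist (radix_sum w \<eta>) \<alpha> < \<epsilon>"
    proof -
      let ?t = "\<lambda>e. radix_sum w (\<lambda>j. e (j + K))"
      have "radix_sum w \<eta> - \<alpha> = w ^ K * (?t \<eta> - ?t \<delta>)"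
        using radix_sum_split[of w \<eta> ?N K, OF w1 absd[OF \<eta>]] radix_sum_split[of w \<delta> ?N K, OF w1 absd[OF \<delta>]]
        unfolding \<alpha>_eq by (simp add: \<eta>_def algebra_simps)
      hence "dist (radix_sum w \<eta>) \<alpha> = norm w ^ K * norm (?t \<eta> - ?t \<delta>)"
        by (simp add: dist_norm norm_mult norm_power)
      also have "norm (?t \<eta> - ?t \<delta>) \<le> norm (?t \<eta>) + norm (?t \<delta>)" by (rule norm_triangle_ineq4)
      also have "\<dots> \<le> c + c"
        unfolding c_def by (intro add_mono norm_radix_sum_le[OF w1]) (use absd \<eta> \<delta> in blast)+
      finally have "dist (radix_sum w \<eta>) \<alpha> \<le> norm w ^ K * (2 * c)"
        by (simp add: mult_left_mono)
      also have "\<dots> \<le> norm w ^ K * (2 * c + 1)" by (intro mult_left_mono) auto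
      also have "\<dots> < \<epsilon>" using K c by (simp add: pos_less_divide_eq)
      finally show ?thesis .
    qed
    ultimately show "\<exists>y\<in>level_set n D l. dist y \<alpha> < \<epsilon>" by blast
  qed
qed

section \<open>Numerical estimates and the three cases\<close>

text \<open>With x = n^2 and |b|^2 = x + 1 the claim reads |b| < (x + 4)/4, which after squaring is
  x > 8. It fails at n = 2, hence the separate treatment of that base.\<close>

lemma sq_less_2_norm_base:
  assumes "n \<ge> 3"
  shows "(real n)\<^sup>2 < 2 * (norm (base n) - 1)\<^sup>2"
proof -
  have "9 \<le> (real n)\<^sup>2" using power_mono[of 3 "real n" 2] assms by simp
  hence "8 * (real n)\<^sup>2 < (real n)\<^sup>2 * (real n)\<^sup>2"
    using assms by (intro mult_strict_right_mono) auto
  hence "(real n)\<^sup>2 + 1 < (((real n)\<^sup>2 + 4) / 4)\<^sup>2"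
    by (simp add: power2_eq_square field_simps)
  hence "norm (base n) < ((real n)\<^sup>2 + 4) / 4"
    unfolding norm_base by (intro real_less_lsqrt) auto
  moreover have "(norm (base n))\<^sup>2 = (real n)\<^sup>2 + 1" by (simp add: norm_base)
  ultimately show ?thesis unfolding power2_diff by simp
qed

text \<open>As before, the claim reads |b| < (x + 6)/6, that is x > 24. This is where n >= 5
  enters.\<close>

lemma sq_less_3_norm_base:
  assumes "n \<ge> 5"
  shows "2 * (real n)\<^sup>2 < 3 * (norm (base n) - 1)\<^sup>2"
proof -
  have "25 \<le> (real n)\<^sup>2" using power_mono[of 5 "real n" 2] assms by simp
  hence "24 * (real n)\<^sup>2 < (real n)\<^sup>2 * (real n)\<^sup>2"
    using assms by (intro mult_strict_right_mono) auto
  hence "(real n)\<^sup>2 + 1 < (((real n)\<^sup>2 + 6) / 6)\<^sup>2"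
    by (simp add: power2_eq_square field_simps)
  hence "norm (base n) < ((real n)\<^sup>2 + 6) / 6"
    unfolding norm_base by (intro real_less_lsqrt) auto
  moreover have "(norm (base n))\<^sup>2 = (real n)\<^sup>2 + 1" by (simp add: norm_base)
  ultimately show ?thesis unfolding power2_diff by simp
qed

theorem theorem1p9:
  fixes n :: nat and D :: "int set"
  assumes "n \<ge> 2"
    and "D \<noteq> {}"
    and "D \<subseteq> {0 .. int (n^2)}"
    and "(D \<subseteq> {0 .. int (n^2 div 2)} \<and>
            (\<forall>\<delta>\<in>diffset D. \<forall>\<delta>'\<in>diffset D. \<bar>\<delta> - \<delta>'\<bar> \<noteq> 1))
       \<or> (n \<ge> 5 \<and> (\<forall>\<delta>\<in>diffset D. \<forall>\<delta>'\<in>diffset D. \<delta> \<noteq> \<delta>' \<longrightarrow> \<bar>\<delta> - \<delta>'\<bar> > 2))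
       \<or> (n \<in> {2,3,4} \<and> (\<forall>\<delta>\<in>diffset D. \<forall>\<delta>'\<in>diffset D. \<delta> \<noteq> \<delta>' \<longrightarrow> \<bar>\<delta> - \<delta>'\<bar> > 3))"
  shows "\<forall>l::real. 0 \<le> l \<and> l \<le> box_dim (Cset n D) \<longrightarrow>
           Fset n D \<subseteq> closure (level_set n D l)"
proof -
  have n: "n \<ge> 1" using assms(1) by simp
  \<comment> \<open>Comparing a difference with 0 lets the separation hypotheses restrict its own
    size, which settles n = 2.\<close>
  have 0: "0 \<in> diffset D" using assms(2) by (force simp: diffset_def)
  note abs = abs_diffset_le[OF assms(3)]
  have "unique_expansions (inverse (base n)) (diffset D)"
    using assms(4)
  proof (elim disjE conjE)
    assume D: "D \<subseteq> {0 .. int (n^2 div 2)}"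
      and sep: "\<forall>\<delta>\<in>diffset D. \<forall>\<delta>'\<in>diffset D. \<bar>\<delta> - \<delta>'\<bar> \<noteq> 1"
    show ?thesis
    proof (cases "n = 2")
      case True
      have "\<delta> \<in> {-2, 0, 2}" if "\<delta> \<in> diffset D" for \<delta>
      proof -
        have "\<bar>\<delta>\<bar> \<le> 2" using abs_diffset_le[OF D that] True by simp
        moreover have "\<bar>\<delta>\<bar> \<noteq> 1" using sep that 0 by force
        ultimately show ?thesis by auto
      qed
      thus ?thesis unfolding True by (intro unique_expansions_base_2[of 2]) auto
    next
      case False
      have "2 * (n^2 div 2) \<le> n^2" by simp
      hence "real (2 * (n^2 div 2)) \<le> real (n^2)" by (simp only: of_nat_le_iff)
      \<comment> \<open>Distinct integers whose distance is not 1 are at least 2 apart, so m = 2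
        with B the floor of n^2/2.\<close>
      hence "real_of_int (2 * int (n^2 div 2)) < of_int 2 * (norm (base n) - 1)\<^sup>2"
        using sq_less_2_norm_base[of n] assms(1) False by (simp add: of_nat_power)
      thus ?thesis
        by (rule unique_expansions_of_separated[OF n abs_diffset_le[OF D], rotated 2])
           (use sep in force)+
    qed
  next
    assume n5: "n \<ge> 5" and sep: "\<forall>\<delta>\<in>diffset D. \<forall>\<delta>'\<in>diffset D. \<delta> \<noteq> \<delta>' \<longrightarrow> \<bar>\<delta> - \<delta>'\<bar> > 2"
    \<comment> \<open>Gaps above 2 mean m = 3, with B = n^2.\<close>
    have "real_of_int (2 * int (n^2)) < of_int 3 * (norm (base n) - 1)\<^sup>2"
      using sq_less_3_norm_base[OF n5] by simp
    thus ?thesis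
      by (rule unique_expansions_of_separated[OF n abs, rotated 2]) (use sep in force)+
  next
    assume n4: "n \<in> {2,3,4}" and sep: "\<forall>\<delta>\<in>diffset D. \<forall>\<delta>'\<in>diffset D. \<delta> \<noteq> \<delta>' \<longrightarrow> \<bar>\<delta> - \<delta>'\<bar> > 3"
    show ?thesis
    proof (cases "n = 2")
      case True
      have "\<delta> \<in> {-4, 0, 4}" if "\<delta> \<in> diffset D" for \<delta>
      proof -
        have "\<bar>\<delta>\<bar> \<le> 4" using abs[OF that] True by simp
        moreover have "\<delta> \<noteq> 0 \<longrightarrow> \<bar>\<delta>\<bar> > 3" using sep that 0 by force
        ultimately show ?thesis by auto
      qed
      thus ?thesis unfolding True by (intro unique_expansions_base_2[of 4]) auto
    next
      case False
      \<comment> \<open>Gaps above 3 mean m = 4 with B = n^2, so the required inequality is twice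
        the estimate for m = 2.\<close>
      have "real_of_int (2 * int (n^2)) < of_int 4 * (norm (base n) - 1)\<^sup>2"
        using sq_less_2_norm_base[of n] n4 False by auto
      thus ?thesis
        by (rule unique_expansions_of_separated[OF n abs, rotated 2]) (use sep in force)+
    qed
  qed
  thus ?thesis using level_set_dense[OF n assms(2,3)] by blast
qed

end
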